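(* Let $(F,v)$ be a henselian valued field (of arbitrary characteristic), and let $(V,\varphi)$ and $(W,\psi)$ be two anisotropic (finite-dimensional) quadratic spaces over $F$ such that the orthogonal sum $\varphi\perp\psi$ is regular. Denote by $\alpha$ and $\beta$ the $v$-value functions on $V$ and $W$ associated to $\varphi$ and $\psi$ respectively, i.e. $\alpha(x)=\frac12 v(\varphi(x))$ for $x\in V$ and $\beta(y)=\frac12 v(\psi(y))$ for $y\in W$. If $\alpha$ is a $v$-norm and $|\Gamma_\alpha:\Gamma_F|=\dim_F(V)$, then the Witt index of $\varphi\perp\psi$ satisfies \[i_w(\varphi\perp\psi)\leq |(\Gamma_\alpha\cap\Gamma_\beta):\Gamma_F|.\]
   Context: The valuation is $v:F\to\Gamma\cup\{\infty\}$, where $\Gamma$ is a divisible totally ordered abelian group (obtained by passing to the divisible hull if necessary), and $\Gamma_F=v(F^\times)\subset\Gamma$ is the value group. A $v$-value function on a finite-dimensional $F$-vector space $V$ is a map $\alpha:V\to\Gamma\cup\{\infty\}$ such that (1) $\alpha(x)=\infty$ if and only if $x=0$; (2) $\alpha(x+y)\geq\min(\alpha(x),\alpha(y))$ for all $x,y\in V$; (3) $\alpha(x\lambda)=\alpha(x)+v(\lambda)$ for all $x\in V$, $\lambda\in F$. Since $v$ is henselian, for an anisotropic quadratic form $\varphi$ on $V$ the function $x\mapsto\frac12v(\varphi(x))$ is known to be a $v$-value function on $V$. The value set of $\alpha$ is $\Gamma_\alpha=\{\alpha(x) : x\in V,\ x\neq 0\}\subset\Gamma$. It is a union of cosets of $\Gamma_F$.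 For a subset $S\subset\Gamma$ that is a union of cosets of $\Gamma_F$, $|S:\Gamma_F|$ denotes the number of cosets of $\Gamma_F$ contained in $S$. A $v$-value function $\alpha$ is called a $v$-norm if $V$ has a splitting base for $\alpha$, i.e. a base $(e_i)_{1\leq i\leq n}$ such that $\alpha(\sum_{i=1}^n e_i\lambda_i)=\min\{\alpha(e_i)+v(\lambda_i) : 1\leq i\leq n\}$ for all $\lambda_1,\dots,\lambda_n\in F$. A quadratic form $q$ on $U$ with polar form $b_q(x,y)=q(x+y)-q(x)-q(y)$ is regular if there is no non-zero $u\in U$ with $q(u)=0$ and $b_q(u,x)=0$ for all $x\in U$. The Witt index $i_w(q)$ of a regular form is the dimension of a maximal totally isotropic subspace (a subspace on which $q$ vanishes identically). *)

theory Defs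
  imports "HOL-Analysis.Product_Vector" "HOL-Computational_Algebra.Polynomial"
begin

section \<open>Value groups\<close>

class divisible_linordered_ab_group_add = linordered_ab_group_add +
  assumes divisible: "\<exists>y. (\<Sum>i<Suc n. y) = x"

text \<open>The description below is well defined: a totally ordered group is torsion free.\<close>

definition half :: "'g::divisible_linordered_ab_group_add \<Rightarrow> 'g"
  where "half g = (THE h. h + h = g)"

lemma half_add_half: "half g + half g = g" for g :: "'g::divisible_linordered_ab_group_add"
proof -
  have "\<exists>h. (\<Sum>i<Suc 1. h) = g"
    by (rule divisible)
  then obtain h where h: "h + h = g"
    by auto
  have uniq: "h' = h" if "h' + h' = g" for h'
  proof (rule ccontr)
    assume "h' \<noteq> h"
    then consider "h' < h" | "h < h'" by fastforce
    then show False
      using add_strict_mono[of h' h h' h] add_strict_mono[of h h' h h'] h that by cases auto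
  qed
  have "(THE h. h + h = g) = h"
    using h uniq by (rule the_equality)
  then show ?thesis
    using h by (simp add: half_def)
qed

text \<open>The set \<open>\<Gamma> \<union> {\<infinity>}\<close>.\<close>

datatype 'g with_infty = Fin 'g | Infty
  for map: map_with_infty

instantiation with_infty :: (linorder) linorder
begin

fun less_eq_with_infty :: "'a with_infty \<Rightarrow> 'a with_infty \<Rightarrow> bool" where
  "x \<le> Infty \<longleftrightarrow> True"
| "Fin a \<le> Fin b \<longleftrightarrow> a \<le> b"
| "Infty \<le> Fin b \<longleftrightarrow> False"

definition less_with_infty :: "'a with_infty \<Rightarrow> 'a with_infty \<Rightarrow> bool"
  where "less_with_infty x y \<longleftrightarrow> x \<le> y \<and> \<not> y \<le> x"

instance
proof
  fix x y z :: "'a with_infty"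
  show "x < y \<longleftrightarrow> x \<le> y \<and> \<not> y \<le> x" by (rule less_with_infty_def)
  show "x \<le> x" by (cases x) auto
  show "x \<le> y \<Longrightarrow> y \<le> z \<Longrightarrow> x \<le> z" by (cases x; cases y; cases z) auto
  show "x \<le> y \<Longrightarrow> y \<le> x \<Longrightarrow> x = y" by (cases x; cases y) auto
  show "x \<le> y \<or> y \<le> x" by (cases x; cases y) auto
qed

end

instantiation with_infty :: (ordered_ab_group_add) comm_monoid_add
begin

fun plus_with_infty :: "'a with_infty \<Rightarrow> 'a with_infty \<Rightarrow> 'a with_infty" where
  "Fin a + Fin b = Fin (a + b)"
| "Infty + y = Infty"
| "x + Infty = Infty"

definition zero_with_infty :: "'a with_infty"
  where "zero_with_infty = Fin 0"

instance
proof
  fix x y z :: "'a with_infty"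
  show "x + y + z = x + (y + z)"
    by (cases x; cases y; cases z) (auto simp: add.assoc)
  show "x + y = y + x"
    by (cases x; cases y) (auto simp: add.commute)
  show "0 + x = x"
    by (cases x) (auto simp: zero_with_infty_def)
qed

end


section \<open>Henselian valuations\<close>

locale valuation =
  fixes v :: "'f::field \<Rightarrow> 'g::linordered_ab_group_add with_infty"
  assumes v_eq_Infty_iff: "v x = Infty \<longleftrightarrow> x = 0"
    and v_mult: "v (x * y) = v x + v y"
    and v_add: "min (v x) (v y) \<le> v (x + y)"

text \<open>Simple zeros in the residue field of monic polynomials over the valuation ring lift.\<close>

locale henselian_valuation = valuation +
  assumes hensel:
    "\<lbrakk>lead_coeff p = 1; \<forall>i. 0 \<le> v (coeff p i); 0 \<le> v a; 0 < v (poly p a); v (poly (pderiv p) a) = 0\<rbrakk>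
      \<Longrightarrow> \<exists>b. 0 \<le> v b \<and> poly p b = 0 \<and> 0 < v (b - a)"

definition value_group :: "('f::field \<Rightarrow> 'g with_infty) \<Rightarrow> 'g set"
  where "value_group v = {g. \<exists>x. x \<noteq> 0 \<and> v x = Fin g}"

definition value_set :: "('v::zero \<Rightarrow> 'g with_infty) \<Rightarrow> 'g set"
  where "value_set \<alpha> = {g. \<exists>x. x \<noteq> 0 \<and> \<alpha> x = Fin g}"

text \<open>The number of cosets of \<open>H\<close> contained in \<open>S\<close>, provided there are only finitely many.\<close>

definition coset_index :: "'g::ab_group_add set \<Rightarrow> 'g set \<Rightarrow> nat"
  where "coset_index S H = card {C. (\<exists>g. C = (+) g ` H) \<and> C \<subseteq> S}"

definition value_function ::
    "('f \<Rightarrow> 'v \<Rightarrow> 'v) \<Rightarrow> ('f::field \<Rightarrow> 'g::linordered_ab_group_add with_infty)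
      \<Rightarrow> ('v::ab_group_add \<Rightarrow> 'g with_infty) \<Rightarrow> bool"
  where "value_function smul v \<alpha> \<longleftrightarrow>
    (\<forall>x. \<alpha> x = Infty \<longleftrightarrow> x = 0) \<and>
    (\<forall>x y. min (\<alpha> x) (\<alpha> y) \<le> \<alpha> (x + y)) \<and>
    (\<forall>x c. \<alpha> (smul c x) = \<alpha> x + v c)"

text \<open>Inserting \<open>Infty\<close> only matters for the empty base of the zero space.\<close>

definition splitting_base ::
    "('f \<Rightarrow> 'v \<Rightarrow> 'v) \<Rightarrow> ('f::field \<Rightarrow> 'g::linordered_ab_group_add with_infty)
      \<Rightarrow> ('v::ab_group_add \<Rightarrow> 'g with_infty) \<Rightarrow> 'v set \<Rightarrow> bool"
  where "splitting_base smul v \<alpha> E \<longleftrightarrow>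
    finite E \<and> \<not> module.dependent smul E \<and> module.span smul E = UNIV \<and>
    (\<forall>c. \<alpha> (\<Sum>e\<in>E. smul (c e) e) = Min (insert Infty ((\<lambda>e. \<alpha> e + v (c e)) ` E)))"

definition v_norm ::
    "('f \<Rightarrow> 'v \<Rightarrow> 'v) \<Rightarrow> ('f::field \<Rightarrow> 'g::linordered_ab_group_add with_infty)
      \<Rightarrow> ('v::ab_group_add \<Rightarrow> 'g with_infty) \<Rightarrow> bool"
  where "v_norm smul v \<alpha> \<longleftrightarrow>
    value_function smul v \<alpha> \<and> (\<exists>E. splitting_base smul v \<alpha> E)"


section \<open>Quadratic forms in arbitrary characteristic\<close>

definition polar :: "('v::ab_group_add \<Rightarrow> 'f::field) \<Rightarrow> 'v \<Rightarrow> 'v \<Rightarrow> 'f"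
  where "polar q x y = q (x + y) - q x - q y"

definition anisotropic :: "('v::ab_group_add \<Rightarrow> 'f::field) \<Rightarrow> bool"
  where "anisotropic q \<longleftrightarrow> (\<forall>x. q x = 0 \<longrightarrow> x = 0)"

definition regular :: "('v::ab_group_add \<Rightarrow> 'f::field) \<Rightarrow> bool"
  where "regular q \<longleftrightarrow> \<not> (\<exists>u. u \<noteq> 0 \<and> q u = 0 \<and> (\<forall>x. polar q u x = 0))"

definition orthogonal_sum ::
    "('v::ab_group_add \<Rightarrow> 'f::field) \<Rightarrow> ('w::ab_group_add \<Rightarrow> 'f) \<Rightarrow> 'v \<times> 'w \<Rightarrow> 'f"
  where "orthogonal_sum \<phi> \<psi> = (\<lambda>(x, y). \<phi> x + \<psi> y)"

definition half_value ::
    "('f::field \<Rightarrow> 'g::divisible_linordered_ab_group_add with_infty) \<Rightarrow> ('v \<Rightarrow> 'f) \<Rightarrow> 'v \<Rightarrow> 'g with_infty"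
  where "half_value v \<phi> x = map_with_infty half (v (\<phi> x))"

definition quadratic_form ::
    "('f \<Rightarrow> 'v \<Rightarrow> 'v) \<Rightarrow> ('v::ab_group_add \<Rightarrow> 'f::field) \<Rightarrow> bool"
  where "quadratic_form smul q \<longleftrightarrow>
    (\<forall>c x. q (smul c x) = c\<^sup>2 * q x) \<and>
    (\<forall>x. Vector_Spaces.linear smul (*) (\<lambda>y. polar q x y)) \<and>
    (\<forall>y. Vector_Spaces.linear smul (*) (\<lambda>x. polar q x y))"

definition totally_isotropic ::
    "('f \<Rightarrow> 'v \<Rightarrow> 'v) \<Rightarrow> ('v::ab_group_add \<Rightarrow> 'f::field) \<Rightarrow> 'v set \<Rightarrow> bool"
  where "totally_isotropic smul q U \<longleftrightarrow> module.subspace smul U \<and> (\<forall>x\<in>U. q x = 0)"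

definition maximal_totally_isotropic ::
    "('f \<Rightarrow> 'v \<Rightarrow> 'v) \<Rightarrow> ('v::ab_group_add \<Rightarrow> 'f::field) \<Rightarrow> 'v set \<Rightarrow> bool"
  where "maximal_totally_isotropic smul q U \<longleftrightarrow>
    totally_isotropic smul q U \<and>
    (\<forall>U'. totally_isotropic smul q U' \<and> U \<subseteq> U' \<longrightarrow> U' = U)"

text \<open>For regular \<open>q\<close> on a finite-dimensional space all maximal totally isotropic subspaces
  have the same dimension; taking the maximum keeps the definition independent of that fact.\<close>

definition witt_index ::
    "('f \<Rightarrow> 'v \<Rightarrow> 'v) \<Rightarrow> ('v::ab_group_add \<Rightarrow> 'f::field) \<Rightarrow> nat"
  where "witt_index smul q =
    Max (vector_space.dim smul ` {U. maximal_totally_isotropic smul q U})"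

end

theory Submission
  imports Defs
begin

text \<open>A totally isotropic subspace of \<open>\<phi> \<perp> \<psi>\<close> projects injectively to \<open>V\<close> by anisotropy, and \<open>\<alpha>\<close> takes
  only values in \<open>\<Gamma>\<^sub>\<alpha> \<inter> \<Gamma>\<^sub>\<beta>\<close> on the nonzero vectors of its image \<open>U\<close>, because \<open>\<phi> x = - \<psi> y\<close> for
  \<open>(x, y)\<close> isotropic. By the hypothesis on \<open>\<Gamma>\<^sub>\<alpha>\<close>, the vectors of a splitting base have values in
  distinct cosets of \<open>\<Gamma>\<^sub>F\<close>. Let \<open>P\<close> be spanned by the base vectors whose coset is not contained in
  \<open>\<Gamma>\<^sub>\<alpha> \<inter> \<Gamma>\<^sub>\<beta>\<close>. The value of a nonzero vector lies in the coset of one of the base vectors involved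
  in it, so \<open>U \<inter> P = 0\<close>, and the dimension of \<open>U\<close> is at most the codimension of \<open>P\<close>.\<close>

context valuation
begin

lemma v_Fin: "x \<noteq> 0 \<Longrightarrow> \<exists>g. v x = Fin g"
  using v_eq_Infty_iff[of x] by (cases "v x") auto

lemma v_one: "v 1 = Fin 0"
  using v_mult[of 1 1] v_Fin[of 1] by auto

text \<open>Since \<open>- 1\<close> squares to \<open>1\<close>, twice its value is zero, and a
  totally ordered group has no torsion.\<close>

lemma v_minus: "v (- x) = v x"
proof -
  obtain g where g: "v (- 1) = Fin g"
    using v_Fin[of "- 1"] by auto
  then have "g + g = 0"
    using v_mult[of "- 1" "- 1"] v_one by simp
  then have "v (- 1) = 0"
    using g by (simp add: zero_with_infty_def)
  then show ?thesis
    using v_mult[of "- 1" x] by simp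
qed

lemma zero_in_value_group: "0 \<in> value_group v"
  unfolding value_group_def using v_one by (auto intro!: exI[of _ 1])

lemma add_in_value_group: "g + h \<in> value_group v"
  if gh: "g \<in> value_group v" "h \<in> value_group v"
proof -
  obtain x y where "x \<noteq> 0" "v x = Fin g" "y \<noteq> 0" "v y = Fin h"
    using gh by (auto simp: value_group_def)
  then show ?thesis
    unfolding value_group_def using v_mult[of x y] by (auto intro!: exI[of _ "x * y"])
qed

lemma uminus_in_value_group: "- g \<in> value_group v" if g: "g \<in> value_group v"
proof -
  obtain x where x: "x \<noteq> 0" "v x = Fin g"
    using g by (auto simp: value_group_def)
  obtain h where h: "v (inverse x) = Fin h"
    using v_Fin[of "inverse x"] x by auto
  have "g + h = 0"
    using v_mult[of x "inverse x"] x h v_one by simp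
  then have "h = - g"
    by (simp add: eq_neg_iff_add_eq_0 add.commute)
  then show ?thesis
    unfolding value_group_def using h x by (auto intro!: exI[of _ "inverse x"])
qed

lemma coset_add: "(+) (g + h) ` value_group v = (+) g ` value_group v"
  if h: "h \<in> value_group v"
proof (intro equalityI subsetI)
  fix k assume "k \<in> (+) (g + h) ` value_group v"
  then show "k \<in> (+) g ` value_group v"
    using add_in_value_group[OF h] by (auto simp: add.assoc)
next
  fix k assume "k \<in> (+) g ` value_group v"
  then obtain l where l: "l \<in> value_group v" "k = g + l" by auto
  then have "k = g + h + (- h + l)" by (simp add: algebra_simps)
  then show "k \<in> (+) (g + h) ` value_group v"
    using add_in_value_group[OF uminus_in_value_group[OF h] l(1)] by blast
qed

end

text \<open>The minimum in the splitting formula is attained at some base vector \<open>e\<close>.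
  As \<open>x\<close> is nonzero the minimum is finite, so \<open>e\<close> has a nonzero
  coefficient.\<close>

lemma (in finite_dimensional_vector_space) value_in_coset_of_splitting_base:
  fixes v :: "'a \<Rightarrow> 'g::linordered_ab_group_add with_infty"
  assumes "valuation v" and vf: "value_function scale v \<alpha>" and sb: "splitting_base scale v \<alpha> E"
    and D: "D \<subseteq> E" and x: "x \<in> span D" "x \<noteq> 0"
  shows "\<exists>e\<in>D. \<exists>a. \<exists>h\<in>value_group v. \<alpha> e = Fin a \<and> \<alpha> x = Fin (a + h)"
proof -
  interpret valuation v by fact
  have fin: "finite E" and min: "\<alpha> (\<Sum>e\<in>E. scale (c e) e) = Min (insert Infty ((\<lambda>e. \<alpha> e + v (c e)) ` E))" for c
    using sb by (auto simp: splitting_base_def)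
  obtain c0 where c0: "x = (\<Sum>e\<in>D. scale (c0 e) e)"
    using x(1) span_finite[OF finite_subset[OF D fin]] by auto
  \<comment> \<open>The splitting formula speaks of all of \<open>E\<close>. Extending the
    coefficients by zero makes it applicable, and a base vector with nonzero coefficient must then
    lie in \<open>D\<close>.\<close>
  define c where "c e = (if e \<in> D then c0 e else 0)" for e
  have xc: "x = (\<Sum>e\<in>E. scale (c e) e)"
    unfolding c0 c_def by (rule sum.mono_neutral_cong_left) (use fin D in auto)
  have "\<alpha> x \<noteq> Infty"
    using vf x(2) by (simp add: value_function_def)
  moreover have "\<alpha> x \<in> insert Infty ((\<lambda>e. \<alpha> e + v (c e)) ` E)"
    unfolding xc min by (rule Min_in) (use fin in auto)
  ultimately obtain e where e: "e \<in> E" "\<alpha> x = \<alpha> e + v (c e)" "\<alpha> e + v (c e) \<noteq> Infty"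
    by auto
  obtain a h where ah: "\<alpha> e = Fin a" "v (c e) = Fin h"
    using e(3) by (cases "\<alpha> e"; cases "v (c e)") auto
  have "c e \<noteq> 0"
    using ah v_eq_Infty_iff[of "c e"] by auto
  then have "e \<in> D" "h \<in> value_group v"
    using ah by (auto simp: c_def value_group_def split: if_splits)
  then show ?thesis
    using e ah by auto
qed

text \<open>Here \<open>T\<close> takes the place of \<Gamma>_\<alpha> \<inter> \<Gamma>_\<beta> and
  \<open>U\<close> that of the projected isotropic subspace.\<close>

lemma (in finite_dimensional_vector_space) dim_le_coset_index:
  fixes v :: "'a \<Rightarrow> 'g::linordered_ab_group_add with_infty"
  assumes val: "valuation v" and vf: "value_function scale v \<alpha>" and sb: "splitting_base scale v \<alpha> E"
    and index: "coset_index (value_set \<alpha>) (value_group v) = dim UNIV"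
    and U: "subspace U" and T: "T \<subseteq> value_set \<alpha>"
    and values_in: "\<And>x g. x \<in> U \<Longrightarrow> \<alpha> x = Fin g \<Longrightarrow> g \<in> T"
  shows "dim U \<le> coset_index T (value_group v)"
proof -
  interpret valuation v by fact
  let ?G = "value_group v"
  define cosets where "cosets S = {C. (\<exists>g. C = (+) g ` ?G) \<and> C \<subseteq> S}" for S
  have fin: "finite E" and indep: "independent E" and span: "span E = UNIV"
    using sb by (auto simp: splitting_base_def)
  have card_E: "card E = dim UNIV"
    using dim_eq_card[of E UNIV] indep span by simp
  define coset where "coset e = (+) (THE a. \<alpha> e = Fin a) ` ?G" for e
  have coset_eq: "coset e = (+) a ` ?G" if "\<alpha> e = Fin a" for e a
    using that by (simp add: coset_def)
  \<comment> \<open>A coset inside the value set contains its representative \<open>g\<close>, which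
    is the value of some vector and therefore lies in the coset of a base vector.\<close>
  have sub: "cosets (value_set \<alpha>) \<subseteq> coset ` E"
  proof
    fix C assume "C \<in> cosets (value_set \<alpha>)"
    then obtain g where C: "C = (+) g ` ?G" "C \<subseteq> value_set \<alpha>"
      by (auto simp: cosets_def)
    then have "g \<in> value_set \<alpha>"
      using zero_in_value_group by force
    then obtain x where x: "x \<noteq> 0" "\<alpha> x = Fin g"
      by (auto simp: value_set_def)
    then obtain e a h where "e \<in> E" "h \<in> ?G" "\<alpha> e = Fin a" "g = a + h"
      using value_in_coset_of_splitting_base[OF val vf sb order_refl, of x] span by auto
    then show "C \<in> coset ` E"
      using C(1) coset_add[of h a] coset_eq[of e a] by (intro image_eqI[of _ _ e]) auto
  qed
  \<comment> \<open>The value set contains \<open>card E\<close> cosets, all of them values of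
    \<open>coset\<close> on \<open>E\<close>. This leaves no room for two base vectors to share a
    coset.\<close>
  have "card E \<le> card (cosets (value_set \<alpha>))"
    using index card_E by (simp add: cosets_def coset_index_def)
  then have "card E \<le> card (coset ` E)"
    using card_mono[OF finite_imageI[OF fin] sub] by simp
  then have inj: "inj_on coset E"
    using card_image_le[OF fin, of coset] fin by (intro eq_card_imp_inj_on) auto
  define S where "S = {e \<in> E. coset e \<subseteq> T}"
  have "coset ` S \<subseteq> cosets T"
    by (auto simp: S_def cosets_def coset_def)
  moreover have "cosets T \<subseteq> cosets (value_set \<alpha>)"
    using T by (auto simp: cosets_def)
  \<comment> \<open>An infinite set has \<open>card\<close> zero, so comparing cardinalities
    requires this finiteness.\<close>
  then have "finite (cosets T)"
    using sub fin by (meson finite_imageI finite_subset)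
  ultimately have "card (coset ` S) \<le> card (cosets T)"
    by (simp add: card_mono)
  moreover have "card (coset ` S) = card S"
    by (rule card_image, rule inj_on_subset[OF inj]) (auto simp: S_def)
  ultimately have card_S: "card S \<le> coset_index T ?G"
    by (simp add: coset_index_def cosets_def)
  \<comment> \<open>The value of a nonzero such \<open>x\<close> would lie in the coset of some
    \<open>e\<close> outside \<open>S\<close>. The multiples of \<open>x\<close> stay in
    \<open>U\<close> and their values fill that coset, which forces it into
    \<open>T\<close>.\<close>
  have "x = 0" if x: "x \<in> U" "x \<in> span (E - S)" for x
  proof (rule ccontr)
    assume "x \<noteq> 0"
    then obtain e a h where e: "e \<in> E - S" "h \<in> ?G" "\<alpha> e = Fin a" "\<alpha> x = Fin (a + h)"
      using value_in_coset_of_splitting_base[OF val vf sb _ x(2)] by auto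
    have "coset e \<subseteq> T"
    proof
      fix k assume "k \<in> coset e"
      then have "k \<in> (+) (a + h) ` ?G"
        unfolding coset_eq[OF e(3)] coset_add[OF e(2)] .
      then obtain c l where c: "v c = Fin l" "k = a + h + l"
        by (auto simp: value_group_def)
      then have "\<alpha> (scale c x) = Fin k"
        using vf e by (simp add: value_function_def)
      then show "k \<in> T"
        using values_in subspace_scale[OF U x(1)] by blast
    qed
    then show False
      using e by (auto simp: S_def)
  qed
  then have "dim (U \<inter> span (E - S)) = 0"
    by auto
  then have "dim U + dim (span (E - S)) = dim {x + y |x y. x \<in> U \<and> y \<in> span (E - S)}"
    using dim_sums_Int[OF U subspace_span, of "E - S"] by linarith
  also have "\<dots> \<le> dim UNIV"
    by (rule dim_subset) simp
  finally have "dim U + dim (span (E - S)) \<le> dim UNIV" .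
  moreover have "dim (span (E - S)) = card E - card S"
  proof -
    have "independent (E - S)"
      using indep by (rule independent_mono) auto
    then show ?thesis
      using fin by (subst dim_span_eq_card_independent) (auto simp: S_def card_Diff_subset)
  qed
  moreover have "card S \<le> card E"
    using fin by (intro card_mono) (auto simp: S_def)
  ultimately show ?thesis
    using card_E card_S by linarith
qed

text \<open>\<open>Max\<close> is informative only on a finite nonempty set, so a maximal totally
  isotropic subspace has to be exhibited. One of largest dimension serves; the zero subspace starts
  the search.\<close>

lemma (in finite_dimensional_vector_space) witt_index_le:
  assumes q0: "q 0 = 0" and bound: "\<And>U. totally_isotropic scale q U \<Longrightarrow> dim U \<le> n"
  shows "witt_index scale q \<le> n"
proof -
  let ?M = "{U. maximal_totally_isotropic scale q U}"
  have "totally_isotropic scale q {0}"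
    using q0 by (simp add: totally_isotropic_def)
  moreover have "\<forall>U. totally_isotropic scale q U \<longrightarrow> dim U < Suc n"
    using bound by (simp add: less_Suc_eq_le)
  ultimately have "\<exists>U. totally_isotropic scale q U \<and> (\<forall>U'. totally_isotropic scale q U' \<longrightarrow> dim U' \<le> dim U)"
    by (rule ex_has_greatest_nat[where f = dim])
  then obtain U where U: "totally_isotropic scale q U"
    and max: "\<And>U'. totally_isotropic scale q U' \<Longrightarrow> dim U' \<le> dim U"
    by blast
  have "U' = U" if "totally_isotropic scale q U'" "U \<subseteq> U'" for U'
    using subspace_dim_equal[of U U'] U max that by (auto simp: totally_isotropic_def)
  then have "U \<in> ?M"
    using U by (auto simp: maximal_totally_isotropic_def)
  moreover have "dim ` ?M \<subseteq> {..n}"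
    using bound by (auto simp: maximal_totally_isotropic_def)
  moreover from this have "finite (dim ` ?M)"
    by (rule finite_subset) simp
  ultimately show ?thesis
    unfolding witt_index_def by (intro Max.boundedI) auto
qed

lemma quadratic_form_zero: "quadratic_form smul q \<Longrightarrow> module smul \<Longrightarrow> q 0 = 0"
  unfolding quadratic_form_def by (metis module.scale_zero_left mult_zero_left power_zero_numeral)

theorem proposition3p1:
  fixes v :: "'f::field \<Rightarrow> 'g::divisible_linordered_ab_group_add with_infty"
    and scaleV :: "'f \<Rightarrow> 'v::ab_group_add \<Rightarrow> 'v" and BV :: "'v set"
    and scaleW :: "'f \<Rightarrow> 'w::ab_group_add \<Rightarrow> 'w" and BW :: "'w set"
    and \<phi> :: "'v \<Rightarrow> 'f" and \<psi> :: "'w \<Rightarrow> 'f"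
    and \<alpha> :: "'v \<Rightarrow> 'g with_infty" and \<beta> :: "'w \<Rightarrow> 'g with_infty"
  assumes "henselian_valuation v"
    and "finite_dimensional_vector_space scaleV BV"
    and "finite_dimensional_vector_space scaleW BW"
    and "quadratic_form scaleV \<phi>" and "anisotropic \<phi>"
    and "quadratic_form scaleW \<psi>" and "anisotropic \<psi>"
    and "regular (orthogonal_sum \<phi> \<psi>)"
    and "\<alpha> = half_value v \<phi>" and "\<beta> = half_value v \<psi>"
    and "v_norm scaleV v \<alpha>"
    and "coset_index (value_set \<alpha>) (value_group v) = vector_space.dim scaleV UNIV"
  shows "witt_index (module_prod.scale scaleV scaleW) (orthogonal_sum \<phi> \<psi>)
    \<le> coset_index (value_set \<alpha> \<inter> value_set \<beta>) (value_group v)"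
proof -
  interpret hv: henselian_valuation v by fact
  interpret finite_dimensional_vector_space_prod scaleV scaleW BV BW
    using assms(2,3) by (simp add: finite_dimensional_vector_space_prod_def vector_space_prod_def
        finite_dimensional_vector_space_pair_def vector_space_pair_def finite_dimensional_vector_space_def)
  interpret pV: finite_dimensional_vector_space_pair_1 scale Basis_pair scaleV ..
  let ?q = "orthogonal_sum \<phi> \<psi>"
  let ?T = "value_set \<alpha> \<inter> value_set \<beta>"
  have \<phi>0: "\<phi> 0 = 0" and \<psi>0: "\<psi> 0 = 0"
    using assms(4,6) quadratic_form_zero vs1.module_axioms vs2.module_axioms by auto
  obtain E where vf: "value_function scaleV v \<alpha>" and E: "splitting_base scaleV v \<alpha> E"
    using assms(11) by (auto simp: v_norm_def)
  show ?thesis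
  proof (rule p.witt_index_le)
    show "?q 0 = 0"
      using \<phi>0 \<psi>0 by (simp add: orthogonal_sum_def zero_prod_def)
  next
    fix U assume "totally_isotropic scale ?q U"
    then have U: "p.subspace U" and iso: "\<And>x y. (x, y) \<in> U \<Longrightarrow> \<phi> x = - \<psi> y"
      by (auto simp: totally_isotropic_def orthogonal_sum_def eq_neg_iff_add_eq_0)
    \<comment> \<open>A difference of two vectors with the same first component is
      \<open>(0, w)\<close> with \<open>\<psi> w = 0\<close>, so \<open>w\<close> vanishes by
      anisotropy.\<close>
    have inj: "inj_on fst U"
    proof (rule inj_onI)
      fix a b assume ab: "a \<in> U" "b \<in> U" "fst a = fst b"
      then have "(0, snd a - snd b) \<in> U"
        using p.subspace_diff[OF U ab(1,2)] by (cases a; cases b) simp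
      then have "\<psi> (snd a - snd b) = 0"
        using iso \<phi>0 by fastforce
      then show "a = b"
        using ab assms(7) by (auto simp: anisotropic_def prod_eq_iff)
    qed
    have "inj_on fst (p.span U)"
      using inj p.span_eq_iff[THEN iffD2, OF U] by (rule ssubst[rotated])
    then have "p.dim U = vs1.dim (fst ` U)"
      by (rule pV.dim_image_eq[OF linear_fst, symmetric])
    also have "\<dots> \<le> coset_index ?T (value_group v)"
    proof (rule vs1.dim_le_coset_index[OF hv.valuation_axioms vf E assms(12)])
      show "vs1.subspace (fst ` U)"
        by (rule pV.linear_subspace_image[OF linear_fst U])
      fix x g assume "x \<in> fst ` U" and g: "\<alpha> x = Fin g"
      then obtain y where "(x, y) \<in> U" by force
      then have "\<beta> y = \<alpha> x"
        using iso by (simp add: assms(9,10) half_value_def hv.v_minus)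
      moreover have "x \<noteq> 0"
        using vf g unfolding value_function_def by (metis with_infty.distinct(1))
      \<comment> \<open>Otherwise \<open>\<phi> x = 0\<close>, against the anisotropy of
        \<open>\<phi>\<close>.\<close>
      moreover have "y \<noteq> 0"
        using iso[OF \<open>(x, y) \<in> U\<close>] \<psi>0 \<open>x \<noteq> 0\<close> assms(5) by (auto simp: anisotropic_def)
      ultimately show "g \<in> ?T"
        using g by (auto simp: value_set_def)
    qed simp
    finally show "p.dim U \<le> coset_index ?T (value_group v)" .
  qed
qed

end
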